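(* Let $r,s$ be positive integers and $G=\mathbb{Z}_2^r\times\mathbb{Z}_4^s$. Let $\alpha=(\alpha_1,\ldots,\alpha_r,\alpha_{r+1},\ldots,\alpha_{r+s})\in G$ (with $\alpha_1,\ldots,\alpha_r\in\mathbb{Z}_2$, $\alpha_{r+1},\ldots,\alpha_{r+s}\in\mathbb{Z}_4$) be a vertex of the power graph $\mathcal{G}(G)$ with $|\alpha|=2$. (i) If $\alpha_i\neq 0$ for some $1\le i\le r$, then $\deg(\alpha)=1$. (ii) If $\alpha_i=0$ for all $1\le i\le r$, then $\deg(\alpha)=2^{r+s}+1$.
   Context: For a finite group $G$, the power graph $\mathcal{G}(G)$ is the simple graph with vertex set $G$ in which two distinct vertices are adjacent if and only if one is a power of the other. $\mathbb{Z}_k^t$ denotes the direct product of $t$ copies of the cyclic group $\mathbb{Z}_k=\{0,1,\ldots,k-1\}$; $|\alpha|$ is the order of $\alpha$ and $\deg(\alpha)$ its degree in $\mathcal{G}(G)$. *)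

theory Defs
  imports "HOL-Algebra.Algebra" "Graph_Theory.Pair_Digraph"
begin

definition cyclic_power :: "nat \<Rightarrow> nat \<Rightarrow> (nat \<Rightarrow> int) monoid" where
  "cyclic_power k t = product_group {1..t} (\<lambda>_. integer_mod_group k)"

text \<open>
  Simple graphs are represented, as usual in the Graph_Theory library, by symmetric loop-free
  digraphs: an edge between \<open>x\<close> and \<open>y\<close> is the pair of arcs \<open>(x, y)\<close> and \<open>(y, x)\<close>.
  In a finite group every integer power is a natural power, so exponents range over \<open>nat\<close>.
\<close>

definition power_graph :: "('a, 'b) monoid_scheme \<Rightarrow> 'a pair_pre_digraph" where
  "power_graph G = \<lparr>
     pverts = carrier G,
     parcs = {(x, y). x \<in> carrier G \<and> y \<in> carrier G \<and> x \<noteq> y \<and>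
       ((\<exists>m::nat. x = y [^]\<^bsub>G\<^esub> m) \<or> (\<exists>m::nat. y = x [^]\<^bsub>G\<^esub> m))} \<rparr>"

lemma pair_graph_power_graph:
  assumes "finite (carrier G)"
  shows "pair_graph (power_graph G)"
proof
  show "finite (parcs (power_graph G))"
    by (rule finite_subset[of _ "carrier G \<times> carrier G"])
      (auto simp: power_graph_def assms)
  show "symmetric (with_proj (power_graph G))"
    unfolding symmetric_def
    by (auto simp: power_graph_def arcs_ends_def arc_to_ends_def intro!: symI)
qed (use assms in \<open>auto simp: power_graph_def\<close>)

text \<open>
  Each undirected edge at \<open>v\<close> contributes exactly one outgoing arc (and one incoming arc), so the
  degree of \<open>v\<close> as a vertex of the simple graph is its out-degree.
\<close>

definition vertex_degree :: "'a pair_pre_digraph \<Rightarrow> 'a \<Rightarrow> nat" where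
  "vertex_degree \<Gamma> v = out_degree (with_proj \<Gamma>) v"

lemma vertex_degree_eq_card_neighbours:
  "vertex_degree \<Gamma> v = card {w. (v, w) \<in> parcs \<Gamma>}"
proof -
  have "out_arcs (with_proj \<Gamma>) v = Pair v ` {w. (v, w) \<in> parcs \<Gamma>}"
    by (auto simp: out_arcs_def)
  then show ?thesis
    by (simp add: vertex_degree_def out_degree_def card_image inj_on_def)
qed

end

theory Submission
  imports Defs
begin

text \<open>
  In a group of exponent dividing 4, a vertex \<open>a\<close> of order 2 has as proper powers only \<open>\<one>\<close>, and it is
  a proper power \<open>x\<^sup>m\<close> only for \<open>m \<equiv> 2\<close> modulo 4, since \<open>x\<^sup>3 = a\<close> would give \<open>x = x\<^sup>9 = a\<^sup>3 = a\<close>. So the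
  neighbours of \<open>a\<close> are \<open>\<one>\<close> and the square roots of \<open>a\<close>. A square in \<open>\<int>\<^sub>2\<^sup>r \<times> \<int>\<^sub>4\<^sup>s\<close> vanishes in the
  first \<open>r\<close> coordinates; conversely, an element of order 2 vanishing there has all its remaining
  coordinates in \<open>{0, 2}\<close>, and each of the \<open>r + s\<close> coordinates of a square root can be chosen in
  exactly two ways.
\<close>

lemma (in group) power_graph_neighbours_of_involution:
  assumes exp4: "\<And>x. x \<in> carrier G \<Longrightarrow> x [^] (4::nat) = \<one>"
    and a: "a \<in> carrier G" and ord: "ord a = 2"
  shows "{w. (a, w) \<in> parcs (power_graph G)}
    = insert \<one> {x \<in> carrier G. x [^] (2::nat) = a}" (is "?N = ?R")
proof
  have a2: "a [^] (2::nat) = \<one>"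
    using pow_ord_eq_1[OF a] ord by simp
  have a_ne: "a \<noteq> \<one>"
    using ord by auto
  show "?N \<subseteq> ?R"
  proof
    fix w
    assume "w \<in> ?N"
    then have w: "w \<in> carrier G" "a \<noteq> w"
      and adj: "(\<exists>m::nat. a = w [^] m) \<or> (\<exists>m::nat. w = a [^] m)"
      by (auto simp: power_graph_def)
    from adj show "w \<in> ?R"
    proof (elim disjE exE)
      fix m :: nat
      assume m: "a = w [^] m"
      \<comment> \<open>As \<open>w [^] 4 = \<one>\<close>, only the residue of \<open>m\<close>
        modulo 4 matters; all residues but 2 are then excluded.\<close>
      have "w [^] m = w [^] (4 * (m div 4) + m mod 4)"
        by simp
      also have "\<dots> = (w [^] (4::nat)) [^] (m div 4) \<otimes> w [^] (m mod 4)"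
        using w by (simp only: nat_pow_mult nat_pow_pow)
      also have "\<dots> = w [^] (m mod 4)"
        using w by (simp add: exp4)
      finally have red: "a = w [^] (m mod 4)"
        using m by simp
      have "m mod 4 \<noteq> 3"
      proof
        assume "m mod 4 = 3"
        then have "a [^] (3::nat) = w [^] (9::nat)"
          using red w by (simp add: nat_pow_pow)
        also have "\<dots> = (w [^] (4::nat)) [^] (2::nat) \<otimes> w"
          using w nat_pow_mult[of w 8 1] by (simp add: nat_pow_pow)
        also have "\<dots> = w"
          using w by (simp add: exp4)
        finally have "a [^] (3::nat) = w" .
        moreover have "a [^] (3::nat) = a"
          using a a2 nat_pow_mult[of a 2 1] by simp
        ultimately show False
          using w by simp
      qed
      \<comment> \<open>Residue 0 would give \<open>a = \<one>\<close>, residue 1 would give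
        \<open>a = w\<close>.\<close>
      moreover have "m mod 4 \<noteq> 0" "m mod 4 \<noteq> 1"
        using red a_ne w by (metis nat_pow_0, metis nat_pow_eone)
      moreover have "m mod 4 < 4"
        by simp
      ultimately have "m mod 4 = 2"
        by linarith
      then show ?thesis
        using red w by simp
    next
      fix m :: nat
      assume m: "w = a [^] m"
      \<comment> \<open>The only powers of \<open>a\<close> are \<open>\<one>\<close> and
        \<open>a\<close> itself, and \<open>a \<noteq> w\<close> leaves
        \<open>\<one>\<close>.\<close>
      have "a [^] m = a [^] (2 * (m div 2) + m mod 2)"
        by simp
      also have "\<dots> = (a [^] (2::nat)) [^] (m div 2) \<otimes> a [^] (m mod 2)"
        using a by (simp only: nat_pow_mult nat_pow_pow)
      also have "\<dots> = a [^] (m mod 2)"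
        using a by (simp add: a2)
      finally have "w = a [^] (m mod 2)"
        using m by simp
      then show ?thesis
        using a w by (cases "m mod 2 = 0") (auto simp: mod2_eq_if)
    qed
  qed
  show "?R \<subseteq> ?N"
  proof
    fix w
    assume "w \<in> ?R"
    then show "w \<in> ?N"
    proof
      assume "w = \<one>"
      then show ?thesis
        using a a_ne by (auto simp: power_graph_def intro: exI[of _ "0::nat"])
    next
      assume "w \<in> {x \<in> carrier G. x [^] (2::nat) = a}"
      then have "w \<in> carrier G" "a = w [^] (2::nat)"
        by auto
      \<comment> \<open>\<open>w = a\<close> would force
        \<open>a = a [^] 2 = \<one>\<close>.\<close>
      moreover from this have "a \<noteq> w"
        using a2 a_ne by auto
      ultimately show ?thesis
        using a by (auto simp: power_graph_def)
    qed
  qed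
qed

text \<open>The successor counts the neighbour \<open>\<one>\<close>, which is not itself a square
  root of \<open>a\<close> because its square is \<open>\<one> \<noteq> a\<close>.\<close>

lemma (in group) vertex_degree_involution:
  assumes "finite (carrier G)" "\<And>x. x \<in> carrier G \<Longrightarrow> x [^] (4::nat) = \<one>"
    and "a \<in> carrier G" "ord a = 2"
  shows "vertex_degree (power_graph G) a = Suc (card {x \<in> carrier G. x [^] (2::nat) = a})"
proof -
  have "a \<noteq> \<one>"
    using assms(4) by auto
  then have "\<one> \<notin> {x \<in> carrier G. x [^] (2::nat) = a}"
    by simp
  then show ?thesis
    using assms
    by (simp add: vertex_degree_eq_card_neighbours power_graph_neighbours_of_involution)
qed

lemma nat_pow_DirProd:
  "x [^]\<^bsub>G \<times>\<times> H\<^esub> (m::nat) = (fst x [^]\<^bsub>G\<^esub> m, snd x [^]\<^bsub>H\<^esub> m)"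
  by (induction m) (simp_all add: DirProd_def split_beta)

text \<open>Reducing modulo \<open>k\<close> after each addition or once at the end gives the same
  residue. The restriction reflects that elements of a product group are extensional
  functions.\<close>

lemma nat_pow_cyclic_power:
  "x [^]\<^bsub>cyclic_power k t\<^esub> (m::nat) = (\<lambda>i\<in>{1..t}. int m * x i mod int k)"
  by (induction m)
    (auto simp: cyclic_power_def fun_eq_iff distrib_right mod_simps add.commute)

lemma carrier_cyclic_power:
  "k > 0 \<Longrightarrow> carrier (cyclic_power k t) = {1..t} \<rightarrow>\<^sub>E {0..<int k}"
  by (simp add: cyclic_power_def carrier_integer_mod_group)

lemma one_cyclic_power: "\<one>\<^bsub>cyclic_power k t\<^esub> = (\<lambda>i\<in>{1..t}. 0)"
  by (simp add: cyclic_power_def)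

lemma group_cyclic_power: "group (cyclic_power k t)"
  by (simp add: cyclic_power_def)

text \<open>Doubling on the integers modulo 4 has kernel and image both equal to {0, 2}; its two
  nonempty fibres are {0, 2} and {1, 3}.\<close>

lemma card_halves_mod_4:
  assumes "b \<in> {0..<4::int}" "2 * b mod 4 = 0"
  shows "card {x \<in> {0..<4::int}. 2 * x mod 4 = b} = 2"
proof -
  have interval: "{0..<4::int} = {0, 1, 2, 3}"
    by auto
  then have "b = 0 \<or> b = 2"
    using assms by auto
  then show ?thesis
  proof
    assume "b = 0"
    then have eq: "{x \<in> {0..<4::int}. 2 * x mod 4 = b} = {0, 2}"
      unfolding interval by auto
    show ?thesis
      unfolding eq by simp
  next
    assume "b = 2"
    then have eq: "{x \<in> {0..<4::int}. 2 * x mod 4 = b} = {1, 3}"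
      unfolding interval by auto
    show ?thesis
      unfolding eq by simp
  qed
qed

lemma card_square_roots_cyclic_power_4:
  assumes b: "b \<in> carrier (cyclic_power 4 s)"
    and sq: "b [^]\<^bsub>cyclic_power 4 s\<^esub> (2::nat) = \<one>\<^bsub>cyclic_power 4 s\<^esub>"
  shows "card {x \<in> carrier (cyclic_power 4 s). x [^]\<^bsub>cyclic_power 4 s\<^esub> (2::nat) = b} = 2 ^ s"
proof -
  have coord: "b i \<in> {0..<4}" "2 * b i mod 4 = 0" if "i \<in> {1..s}" for i
    using b that fun_cong[OF sq, of i]
    by (auto simp: carrier_cyclic_power nat_pow_cyclic_power one_cyclic_power PiE_iff)
  \<comment> \<open>Squaring doubles each coordinate separately, so the coordinates of a root are
    chosen independently.\<close>
  have "{x \<in> carrier (cyclic_power 4 s). x [^]\<^bsub>cyclic_power 4 s\<^esub> (2::nat) = b}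
      = (\<Pi>\<^sub>E i\<in>{1..s}. {x \<in> {0..<4}. 2 * x mod 4 = b i})"
    using b
    by (fastforce simp: carrier_cyclic_power nat_pow_cyclic_power PiE_iff fun_eq_iff
        extensional_def)
  then have "card {x \<in> carrier (cyclic_power 4 s). x [^]\<^bsub>cyclic_power 4 s\<^esub> (2::nat) = b}
      = (\<Prod>i\<in>{1..s}. card {x \<in> {0..<4}. 2 * x mod 4 = b i})"
    by (simp add: card_PiE)
  also have "\<dots> = (\<Prod>i\<in>{1..s}. 2)"
    using coord by (intro prod.cong card_halves_mod_4) auto
  finally show ?thesis
    by simp
qed

theorem theorem3p9:
  fixes r s :: nat
    and G :: "((nat \<Rightarrow> int) \<times> (nat \<Rightarrow> int)) monoid"
    and \<alpha> :: "(nat \<Rightarrow> int) \<times> (nat \<Rightarrow> int)"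
  assumes "r > 0" and "s > 0"
    and "G = cyclic_power 2 r \<times>\<times> cyclic_power 4 s"
    and "\<alpha> \<in> pverts (power_graph G)"
    and "group.ord G \<alpha> = 2"
  shows "((\<exists>i\<in>{1..r}. fst \<alpha> i \<noteq> 0) \<longrightarrow> vertex_degree (power_graph G) \<alpha> = 1) \<and>
    ((\<forall>i\<in>{1..r}. fst \<alpha> i = 0) \<longrightarrow> vertex_degree (power_graph G) \<alpha> = 2 ^ (r + s) + 1)"
proof -
  let ?A = "cyclic_power 2 r" and ?B = "cyclic_power 4 s"
  let ?roots = "{x \<in> carrier G. x [^]\<^bsub>G\<^esub> (2::nat) = \<alpha>}"
  interpret group G
    unfolding assms(3) by (intro DirProd_group group_cyclic_power)
  have carrier: "carrier G = carrier ?A \<times> carrier ?B"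
    by (simp add: assms(3))
  have \<alpha>: "\<alpha> \<in> carrier G"
    using assms(4) by (simp add: power_graph_def)
  have degree: "vertex_degree (power_graph G) \<alpha> = Suc (card ?roots)"
  proof (rule vertex_degree_involution)
    show "finite (carrier G)"
      by (simp add: carrier carrier_cyclic_power finite_PiE)
    show "x [^]\<^bsub>G\<^esub> (4::nat) = \<one>\<^bsub>G\<^esub>" if "x \<in> carrier G" for x
      \<comment> \<open>The exponent 4 is a multiple of both moduli, 2 and 4.\<close>
      by (auto simp: assms(3) nat_pow_DirProd nat_pow_cyclic_power one_cyclic_power fun_eq_iff
          restrict_def)
  qed (use \<alpha> assms(5) in auto)
  have roots: "?roots = {x \<in> carrier ?A. x [^]\<^bsub>?A\<^esub> (2::nat) = fst \<alpha>}
      \<times> {x \<in> carrier ?B. x [^]\<^bsub>?B\<^esub> (2::nat) = snd \<alpha>}"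
    unfolding carrier by (auto simp: assms(3) nat_pow_DirProd)
  \<comment> \<open>This decides both cases: a nonzero \<open>fst \<alpha>\<close> has no root in
    \<open>?A\<close>, while the zero element has every element of \<open>?A\<close> as a
    root.\<close>
  have sq_A: "x [^]\<^bsub>?A\<^esub> (2::nat) = (\<lambda>i\<in>{1..r}. 0)" for x
    by (simp add: nat_pow_cyclic_power)
  show ?thesis
  proof (intro conjI impI)
    assume "\<exists>i\<in>{1..r}. fst \<alpha> i \<noteq> 0"
    then have "(\<lambda>i\<in>{1..r}. 0) \<noteq> fst \<alpha>"
      by (metis restrict_apply')
    then have "?roots = {}"
      by (simp add: roots sq_A)
    then show "vertex_degree (power_graph G) \<alpha> = 1"
      by (simp only: degree card.empty)
  next
    assume zero: "\<forall>i\<in>{1..r}. fst \<alpha> i = 0"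
    \<comment> \<open>Extensionality fixes the values outside the index range, so vanishing
      coordinates determine \<open>fst \<alpha>\<close>.\<close>
    have "fst \<alpha> \<in> extensional {1..r}"
      using \<alpha> by (auto simp: carrier carrier_cyclic_power PiE_iff)
    then have "fst \<alpha> = (\<lambda>i\<in>{1..r}. 0)"
      by (rule extensionalityI) (use zero in auto)
    then have "{x \<in> carrier ?A. x [^]\<^bsub>?A\<^esub> (2::nat) = fst \<alpha>} = carrier ?A"
      by (simp add: sq_A)
    moreover have "card (carrier ?A) = 2 ^ r"
      by (simp add: carrier_cyclic_power card_PiE)
    moreover have "card {x \<in> carrier ?B. x [^]\<^bsub>?B\<^esub> (2::nat) = snd \<alpha>} = 2 ^ s"
    proof (rule card_square_roots_cyclic_power_4)
      show "snd \<alpha> \<in> carrier ?B"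
        using \<alpha> by (auto simp: carrier)
      have "\<alpha> [^]\<^bsub>G\<^esub> (2::nat) = \<one>\<^bsub>G\<^esub>"
        using pow_ord_eq_1[OF \<alpha>] assms(5) by simp
      then show "snd \<alpha> [^]\<^bsub>?B\<^esub> (2::nat) = \<one>\<^bsub>?B\<^esub>"
        by (simp add: assms(3) nat_pow_DirProd)
    qed
    ultimately have "card ?roots = 2 ^ r * 2 ^ s"
      unfolding roots by (simp only: card_cartesian_product)
    then show "vertex_degree (power_graph G) \<alpha> = 2 ^ (r + s) + 1"
      by (simp add: degree power_add)
  qed
qed

end
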